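(* Let $(P_n)_{n\ge 0}$ be the Rudin-Shapiro polynomials and let $X_n = P_n/\|P_n\|_2 = P_n/2^{n/2}$ be their $L^2$-normalizations. Then, for every real number $\alpha \ge 0$, the sequence $(X_n)$ is not $L^\alpha$-flat.
   Context: $S^1$ is the unit circle in $\mathbb{C}$ and $dz$ denotes normalized Lebesgue measure on $S^1$. The Rudin-Shapiro polynomials $P_n, Q_n$ are defined inductively by $P_0=Q_0=1$ and, for $n\ge 0$, $P_{n+1}(z)=P_n(z)+z^{2^n}Q_n(z)$, $Q_{n+1}(z)=P_n(z)-z^{2^n}Q_n(z)$. For $\alpha>0$, $\|f\|_\alpha = \left(\int_{S^1}|f|^\alpha\,dz\right)^{1/\alpha}$ (a quasi-norm if $\alpha<1$), and $\|f\|_0=M(f)=\exp\left(\int_{S^1}\log|f|\,dz\right)$ is the Mahler measure. A sequence $(p_n)$ of analytic trigonometric polynomials (polynomials in $z$ restricted to $S^1$) with $\|p_n\|_2=1$ is called $L^\alpha$-flat, for $\alpha>0$, if $\big\||p_n|-1\big\|_\alpha\to 0$ as $n\to\infty$; it is called $L^0$-flat if $M(p_n)\to 1$ as $n\to\infty$. *)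

theory Defs
  imports "HOL-Analysis.Analysis" "HOL-Computational_Algebra.Polynomial"
begin

text \<open>Normalized Lebesgue measure on the unit circle: the image of the uniform distribution
  on \<open>[0, 2\<pi>)\<close> under \<open>t \<mapsto> e\<^sup>i\<^sup>t\<close>.\<close>

definition circle_measure :: "complex measure" where
  "circle_measure =
     distr (uniform_measure lborel {0..<2 * pi}) (restrict_space borel (sphere 0 1)) cis"

text \<open>Intended for \<open>\<alpha> > 0\<close>.\<close>

definition circle_norm :: "real \<Rightarrow> (complex \<Rightarrow> 'a::real_normed_vector) \<Rightarrow> real" where
  "circle_norm \<alpha> f = (LINT z|circle_measure. norm (f z) powr \<alpha>) powr (1 / \<alpha>)"

text \<open>The exponential of the mean of \<open>log |f|\<close>, with \<open>exp (-\<infinity>) = 0\<close>. For bounded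
  measurable \<open>f\<close> the mean of \<open>log |f|\<close> is \<open>-\<infinity>\<close> exactly when \<open>f\<close> vanishes on a set of positive
  measure or \<open>log |f|\<close> is not integrable. The first condition is needed because
  \<open>ln 0 = 0\<close> in HOL.\<close>

definition mahler_measure :: "(complex \<Rightarrow> complex) \<Rightarrow> real" where
  "mahler_measure f =
     (if (AE z in circle_measure. f z \<noteq> 0) \<and> integrable circle_measure (\<lambda>z. ln (norm (f z)))
      then exp (LINT z|circle_measure. ln (norm (f z)))
      else 0)"

text \<open>Flatness is meant for \<open>\<alpha> \<ge> 0\<close> and sequences with \<open>circle_norm 2 (poly (p n)) = 1\<close>.
  The normalization is not part of the predicate, so that its negation
  always refers to the failure of convergence.\<close>

definition L_flat :: "real \<Rightarrow> (nat \<Rightarrow> complex poly) \<Rightarrow> bool" where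
  "L_flat \<alpha> p \<longleftrightarrow>
     (if \<alpha> = 0 then (\<lambda>n. mahler_measure (poly (p n))) \<longlonglongrightarrow> 1
      else (\<lambda>n. circle_norm \<alpha> (\<lambda>z. norm (poly (p n) z) - 1)) \<longlonglongrightarrow> 0)"

fun rudin_shapiro_P :: "nat \<Rightarrow> complex poly"
  and rudin_shapiro_Q :: "nat \<Rightarrow> complex poly" where
  "rudin_shapiro_P 0 = 1"
| "rudin_shapiro_Q 0 = 1"
| "rudin_shapiro_P (Suc n) = rudin_shapiro_P n + monom 1 (2 ^ n) * rudin_shapiro_Q n"
| "rudin_shapiro_Q (Suc n) = rudin_shapiro_P n - monom 1 (2 ^ n) * rudin_shapiro_Q n"

definition rudin_shapiro_normalized :: "nat \<Rightarrow> complex poly" where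
  "rudin_shapiro_normalized n =
     smult (complex_of_real (1 / circle_norm 2 (poly (rudin_shapiro_P n)))) (rudin_shapiro_P n)"

end

theory Submission
  imports Defs "HOL-Probability.Probability_Measure"
begin

text \<open>
  Write \<open>X\<^sub>n\<close> for the normalized polynomials and \<open>u\<^sub>n = |X\<^sub>n|\<^sup>2 - 1\<close>. The reason for non-flatness
  is that no three consecutive \<open>X\<^sub>n\<close> can all be close to unimodular in mean. Put \<open>w = z^(2^n)\<close> and
  \<open>c = w Q\<^sub>n cnj P\<^sub>n / 2^n\<close>. The parallelogram law gives \<open>|P\<^sub>n|\<^sup>2 + |Q\<^sub>n|\<^sup>2 = 2^(n+1)\<close>, so
  \<open>|c|\<^sup>2 = (1 - u\<^sub>n) (1 + u\<^sub>n)\<close>, and the recursion gives \<open>u\<^sub>n\<^sub>+\<^sub>1 = Re c\<close>. If \<open>u\<^sub>n\<close> and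
  \<open>u\<^sub>n\<^sub>+\<^sub>1\<close> are both small, then \<open>c\<close> is close to \<open>\<i>\<close> or \<open>-\<i>\<close>. One further step of the recursion
  gives \<open>u\<^sub>n\<^sub>+\<^sub>2 = Re (w\<^sup>2) u\<^sub>n + Im (w\<^sup>2) Im c\<close>, which is then close to \<open>Im (w\<^sup>2)\<close> up to sign.
  The quantitative form \<open>three_step_inequality\<close> reads
  \<open>(Im (w\<^sup>2))\<^sup>2 \<le> 3 u\<^sub>n\<^sup>2 + u\<^sub>n\<^sub>+\<^sub>1\<^sup>2 + 2 u\<^sub>n\<^sub>+\<^sub>2\<^sup>2\<close>. The left-hand side is the square of the sine of
  \<open>2^(n+1)\<close> times the argument of \<open>z\<close>, with mean \<open>1/2\<close> for every \<open>n\<close>. So the means of \<open>u\<^sub>n\<^sup>2\<close>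
  cannot tend to 0, and neither can those of \<open>(|X\<^sub>n| - 1)\<^sup>2\<close>, because \<open>|X\<^sub>n| \<le> \<surd>2\<close>
  (\<open>rudin_shapiro_not_L2_flat\<close>).

  Flatness in any exponent would force exactly this convergence. For \<open>\<alpha> > 0\<close> the functions
  \<open>|X\<^sub>n| - 1\<close> are uniformly bounded by 1, so convergence to 0 in exponent \<open>\<alpha>\<close> implies convergence
  to 0 in exponent 2 (\<open>square_integral_tendsto_0\<close>). For \<open>\<alpha> = 0\<close> the inequality \<open>ln x \<le> x - 1\<close> and
  \<open>\<parallel>X\<^sub>n\<parallel>\<^sub>2 = 1\<close> give that the mean of \<open>(|X\<^sub>n| - 1)\<^sup>2\<close> is at most \<open>- 2 ln M(X\<^sub>n)\<close>
  (\<open>rudin_shapiro_L2_dist_le_mahler\<close>).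

  The value of the \<open>L\<^sup>2\<close> norm follows from \<open>|P\<^sub>n\<^sub>+\<^sub>1|\<^sup>2 = 2^(n+1) (1 + Re c)\<close>: since \<open>P\<^sub>n\<close> has degree
  below \<open>2^n\<close>, all frequencies in \<open>c\<close> are positive and its mean is 0 (\<open>circle_orthogonal\<close>).
\<close>

section \<open>Integration over the circle\<close>

lemma emeasure_period: "emeasure lborel {0..<2 * pi} = ennreal (2 * pi)"
  by simp

lemma cis_measurable_circle:
  "cis \<in> measurable (uniform_measure lborel {0..<2 * pi}) (restrict_space borel (sphere 0 1))"
proof -
  have "cis \<in> borel_measurable borel"
    by (intro borel_measurable_continuous_onI continuous_intros)
  then have "cis \<in> measurable borel (restrict_space borel (sphere 0 1))"
    by (intro measurable_restrict_space2) auto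
  then show ?thesis
    by (simp cong: measurable_cong_sets)
qed

lemma prob_space_circle_measure: "prob_space circle_measure"
  unfolding circle_measure_def
  by (intro prob_space.prob_space_distr cis_measurable_circle prob_space_uniform_measure)
     (simp_all add: emeasure_period ennreal_eq_0_iff not_le)

interpretation circle: prob_space circle_measure
  by (rule prob_space_circle_measure)

lemma space_circle_measure: "space circle_measure = sphere 0 1"
  by (simp add: circle_measure_def space_restrict_space)

lemma measurable_circle_continuous:
  fixes f :: "complex \<Rightarrow> 'a::topological_space"
  assumes "continuous_on (sphere 0 1) f"
  shows "f \<in> borel_measurable circle_measure"
  using borel_measurable_continuous_on_restrict[OF assms]
  by (simp add: circle_measure_def cong: measurable_cong_sets)

lemma integrable_circle_continuous:
  fixes f :: "complex \<Rightarrow> 'a::{banach, second_countable_topology}"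
  assumes "continuous_on (sphere 0 1) f"
  shows "integrable circle_measure f"
proof -
  have "bounded (f ` sphere 0 1)"
    by (intro compact_imp_bounded compact_continuous_image assms) auto
  then obtain B where "\<And>z. z \<in> sphere 0 1 \<Longrightarrow> norm (f z) \<le> B"
    unfolding bounded_iff by blast
  then show ?thesis
    by (intro circle.integrable_const_bound[where B = B] AE_I2 measurable_circle_continuous assms)
       (simp add: space_circle_measure)
qed

lemma circle_integral_Re:
  assumes "continuous_on (sphere 0 1) f"
  shows "(LINT z|circle_measure. Re (f z)) = Re (LINT z|circle_measure. f z)"
  by (rule integral_bounded_linear[OF bounded_linear_Re integrable_circle_continuous[OF assms]])

text \<open>The measure lives on a half-open period; the closed interval on the right
  is the form that the fundamental theorem of calculus expects.\<close>

lemma circle_integral_cis: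
  fixes f :: "complex \<Rightarrow> 'a::{banach, second_countable_topology}"
  assumes "continuous_on (sphere 0 1) f"
  shows "(LINT z|circle_measure. f z)
       = (1 / (2 * pi)) *\<^sub>R (LINT t|lborel. indicator {0..2 * pi} t *\<^sub>R f (cis t))"
proof -
  have cont: "continuous_on UNIV (\<lambda>t. f (cis t))"
    by (intro continuous_on_compose2[OF assms] continuous_intros) auto
  have meas [measurable]: "(\<lambda>t. f (cis t)) \<in> borel_measurable borel"
    by (intro borel_measurable_continuous_onI cont)
  have dens: "uniform_measure lborel {0..<2 * pi}
      = density lborel (\<lambda>t. ennreal (indicator {0..<2 * pi} t / (2 * pi)))"
    unfolding uniform_measure_def emeasure_period
    by (intro density_cong) (auto simp: indicator_def divide_ennreal ennreal_1[symmetric]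
        simp del: ennreal_1)
  have "(LINT z|circle_measure. f z) = (LINT t|uniform_measure lborel {0..<2 * pi}. f (cis t))"
    unfolding circle_measure_def
    by (intro integral_distr cis_measurable_circle borel_measurable_continuous_on_restrict assms)
  also have "\<dots> = (LINT t|lborel. (indicator {0..<2 * pi} t / (2 * pi)) *\<^sub>R f (cis t))"
    unfolding dens by (subst integral_density) auto
  also have "\<dots> = (LINT t|lborel. (1 / (2 * pi)) *\<^sub>R (indicator {0..2 * pi} t *\<^sub>R f (cis t)))"
    by (intro integral_cong_AE AE_mp[OF AE_lborel_singleton[of "2 * pi"] AE_I2])
       (auto simp: indicator_def)
  finally show ?thesis
    by (simp only: integral_scaleR_right)
qed

lemma circle_integral_power:
  assumes "k > 0"
  shows "(LINT z|circle_measure. z ^ k) = 0"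
proof -
  have "(LINT t|lborel. indicator {0..2 * pi} t *\<^sub>R cis (real k * t))
      = cis (real k * (2 * pi)) / (\<i> * of_nat k) - cis (real k * 0) / (\<i> * of_nat k)"
  proof (rule integral_FTC_Icc)
    show "((\<lambda>t. cis (real k * t) / (\<i> * of_nat k)) has_vector_derivative cis (real k * t))
            (at t within {0..2 * pi})" for t
      using assms
      unfolding has_vector_derivative_def
      by (auto intro!: derivative_eq_intros simp: scaleR_conv_of_real field_simps)
  qed (auto intro!: continuous_intros)
  also have "cis (real k * (2 * pi)) = 1"
    by (metis cis_multiple_2pi Ints_of_nat mult.commute)
  finally show ?thesis
    by (subst circle_integral_cis) (auto intro!: continuous_intros simp: Complex.DeMoivre)
qed

lemma circle_integral_poly: "(LINT z|circle_measure. z * poly p z) = 0"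
proof -
  have "(LINT z|circle_measure. z * poly p z)
      = (LINT z|circle_measure. (\<Sum>i\<le>degree p. coeff p i * z ^ Suc i))"
    by (simp add: poly_altdef sum_distrib_left mult_ac)
  also have "\<dots> = (\<Sum>i\<le>degree p. (LINT z|circle_measure. coeff p i * z ^ Suc i))"
    by (intro Bochner_Integration.integral_sum integrable_circle_continuous continuous_intros)
  also have "\<dots> = 0"
    by (simp add: circle_integral_power del: power_Suc)
  finally show ?thesis .
qed

text \<open>On the circle \<open>z^N * cnj (z^j) = z^(N - j)\<close>. With \<open>degree q < N\<close> all these exponents are
  positive, so the integrand is \<open>z\<close> times a polynomial: the conjugated, reversed polynomial \<open>r\<close>
  of \<open>q\<close> replaces \<open>cnj q\<close>.\<close>

lemma circle_orthogonal:
  assumes "degree q < N"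
  shows "(LINT z|circle_measure. z ^ N * poly p z * cnj (poly q z)) = 0"
proof -
  define r where "r = (\<Sum>j\<le>degree q. monom (cnj (coeff q j)) (N - 1 - j))"
  have "z ^ N * cnj (poly q z) = z * poly r z" if z: "norm z = 1" for z
  proof -
    have pow: "z ^ N * cnj z ^ j = z * z ^ (N - 1 - j)" if "j \<le> degree q" for j
    proof -
      have "z ^ N = z ^ Suc (N - 1 - j) * z ^ j"
        using assms that by (subst power_add[symmetric]) simp
      moreover have "z ^ j * cnj z ^ j = 1"
        using z by (simp add: power_mult_distrib[symmetric] complex_norm_square[symmetric])
      ultimately show ?thesis
        by (simp add: mult.assoc)
    qed
    have "z ^ N * cnj (poly q z) = (\<Sum>j\<le>degree q. cnj (coeff q j) * (z ^ N * cnj z ^ j))"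
      by (simp add: poly_altdef sum_distrib_left mult_ac)
    also have "\<dots> = (\<Sum>j\<le>degree q. cnj (coeff q j) * (z * z ^ (N - 1 - j)))"
      by (intro sum.cong refl) (simp add: pow)
    also have "\<dots> = z * poly r z"
      by (simp add: r_def poly_sum poly_monom sum_distrib_left mult_ac)
    finally show ?thesis .
  qed
  then have "(LINT z|circle_measure. z ^ N * poly p z * cnj (poly q z))
      = (LINT z|circle_measure. z * poly (p * r) z)"
    by (intro Bochner_Integration.integral_cong) (auto simp: space_circle_measure mult_ac)
  then show ?thesis
    by (simp only: circle_integral_poly)
qed

lemma circle_integral_Im_power:
  assumes "k > 0"
  shows "(LINT z|circle_measure. (Im (z ^ k))\<^sup>2) = 1 / 2"
proof -
  have "(Im (z ^ k))\<^sup>2 = 1 / 2 - Re (z ^ (2 * k)) / 2" if "norm z = 1" for z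
  proof -
    have "(Re (z ^ k))\<^sup>2 + (Im (z ^ k))\<^sup>2 = 1"
      using that by (simp add: cmod_power2[symmetric] norm_power)
    moreover have "Re (z ^ (2 * k)) = (Re (z ^ k))\<^sup>2 - (Im (z ^ k))\<^sup>2"
      by (simp add: mult_2 power_add power2_eq_square)
    ultimately show ?thesis
      by linarith
  qed
  then have "(LINT z|circle_measure. (Im (z ^ k))\<^sup>2)
      = (LINT z|circle_measure. 1 / 2 - Re (z ^ (2 * k)) / 2)"
    by (intro Bochner_Integration.integral_cong) (auto simp: space_circle_measure)
  also have "\<dots> = 1 / 2 - (LINT z|circle_measure. Re (z ^ (2 * k))) / 2"
    by (subst Bochner_Integration.integral_diff)
       (auto intro!: integrable_circle_continuous continuous_intros simp: circle.prob_space)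
  also have "(LINT z|circle_measure. Re (z ^ (2 * k))) = 0"
    using assms circle_integral_Re[of "\<lambda>z. z ^ (2 * k)"]
    by (simp add: circle_integral_power continuous_on_power)
  finally show ?thesis
    by simp
qed

section \<open>Three consecutive Rudin-Shapiro polynomials\<close>

lemma norm_add_square_complex:
  fixes p q :: complex
  shows "(norm (p + q))\<^sup>2 = (norm p)\<^sup>2 + (norm q)\<^sup>2 + 2 * Re (q * cnj p)"
  unfolding cmod_power2 by (simp add: power2_eq_square algebra_simps)

text \<open>The geometric core, for a single point: two steps of the recursion start from a pair
  \<open>(p, q)\<close> on the sphere of radius \<open>\<surd>2\<close> in \<open>\<complex>\<^sup>2\<close>, with twists \<open>w\<close> and \<open>w\<^sup>2\<close>.
  If \<open>p\<close> and \<open>p'\<close> have nearly their average size, then the cross term \<open>c\<close> is nearly \<open>\<plusminus>\<i>\<close>, and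
  the size of the third polynomial then deviates from its average by about \<open>\<plusminus>Im (w\<^sup>2)\<close>.\<close>

lemma three_step_inequality:
  fixes p q w :: complex
  defines "p' \<equiv> p + w * q" and "q' \<equiv> p - w * q"
  assumes w: "norm w = 1" and pq: "(norm p)\<^sup>2 + (norm q)\<^sup>2 = 2"
  shows "(Im (w\<^sup>2))\<^sup>2 \<le> 3 * ((norm p)\<^sup>2 - 1)\<^sup>2 + ((norm p')\<^sup>2 / 2 - 1)\<^sup>2
                      + 2 * ((norm (p' + w\<^sup>2 * q'))\<^sup>2 / 4 - 1)\<^sup>2"
proof -
  define c where "c = w * q * cnj p"
  define u where "u = (norm p)\<^sup>2 - 1"
  define a b where "a = Re (w\<^sup>2)" and "b = Im (w\<^sup>2)"
  have ab: "a\<^sup>2 + b\<^sup>2 = 1"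
    using w by (simp add: a_def b_def cmod_power2[symmetric] norm_power)
  then have ab_le: "a\<^sup>2 \<le> 1" "b\<^sup>2 \<le> 1"
    using zero_le_power2[of a] zero_le_power2[of b] by linarith+
  have nq: "(norm (w * q))\<^sup>2 = 1 - u"
    using w pq by (simp add: u_def norm_mult)
  have np: "(norm p)\<^sup>2 = 1 + u"
    by (simp add: u_def)
  have u1: "(norm p')\<^sup>2 / 2 - 1 = Re c"
    unfolding p'_def norm_add_square_complex[of p] nq np c_def[symmetric] by argo
  have u1': "(norm q')\<^sup>2 / 2 - 1 = - Re c"
  proof -
    have "(norm q')\<^sup>2 = (1 + u) + (1 - u) + 2 * Re (- c)"
      using norm_add_square_complex[of p "- (w * q)"]
      unfolding norm_minus_cancel nq np mult_minus_left c_def[symmetric] q'_def by simp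
    then show ?thesis
      by (simp add: diff_divide_distrib)
  qed
  have c2: "(Re c)\<^sup>2 + (Im c)\<^sup>2 = 1 - u\<^sup>2"
  proof -
    have "(norm c)\<^sup>2 = (norm (w * q))\<^sup>2 * (norm p)\<^sup>2"
      by (simp add: c_def norm_mult power_mult_distrib)
    also have "\<dots> = 1 - u\<^sup>2"
      unfolding nq np by (simp add: power2_eq_square algebra_simps)
    finally show ?thesis
      by (simp only: cmod_power2)
  qed
  \<comment> \<open>The cross term of the second step: its real part is governed by \<open>u\<close>, its imaginary part
     by \<open>Im c\<close>.\<close>
  have "q' * cnj p' = p * cnj p - (w * q) * cnj (w * q) - (c - cnj c)"
    by (simp add: p'_def q'_def c_def algebra_simps)
  also have "\<dots> = of_real (2 * u) - 2 * \<i> * of_real (Im c)"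
    by (simp only: complex_norm_square[symmetric] nq np complex_diff_cnj)
       (simp add: algebra_simps)
  finally have cross: "q' * cnj p' = of_real (2 * u) - 2 * \<i> * of_real (Im c)" .
  have "Re (w\<^sup>2 * q' * cnj p') = 2 * (a * u + b * Im c)"
    unfolding mult.assoc cross by (simp add: a_def b_def algebra_simps)
  moreover have "(norm (w\<^sup>2 * q'))\<^sup>2 = (norm q')\<^sup>2"
    using w by (simp add: norm_mult norm_power)
  ultimately have u2: "(norm (p' + w\<^sup>2 * q'))\<^sup>2 / 4 - 1 = a * u + b * Im c"
    using u1 u1' unfolding norm_add_square_complex[of p'] by argo
  define v where "v = a * u + b * Im c"
  \<comment> \<open>Eliminate \<open>Im c\<close> between \<open>c2\<close> and \<open>u2\<close>.\<close>
  have "1 - u\<^sup>2 - (Re c)\<^sup>2 = (Im c)\<^sup>2"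
    using c2 by simp
  then have "b\<^sup>2 * (1 - u\<^sup>2 - (Re c)\<^sup>2) = (v - a * u)\<^sup>2"
    by (simp only: v_def add_diff_cancel_left' power_mult_distrib)
  also have "\<dots> \<le> 2 * v\<^sup>2 + 2 * (a\<^sup>2 * u\<^sup>2)"
    using zero_le_power2[of "v + a * u"] by (simp add: power2_eq_square algebra_simps)
  also have "\<dots> \<le> 2 * v\<^sup>2 + 2 * u\<^sup>2"
    using mult_right_mono[OF ab_le(1), of "u\<^sup>2"] by simp
  finally have "b\<^sup>2 \<le> b\<^sup>2 * (u\<^sup>2 + (Re c)\<^sup>2) + 2 * v\<^sup>2 + 2 * u\<^sup>2"
    by (simp add: algebra_simps)
  also have "\<dots> \<le> 3 * u\<^sup>2 + (Re c)\<^sup>2 + 2 * v\<^sup>2"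
    using mult_right_mono[OF ab_le(2), of "u\<^sup>2 + (Re c)\<^sup>2"] by simp
  finally show ?thesis
    by (simp only: b_def u_def u1 u2 v_def)
qed

lemma rudin_shapiro_sum_squares:
  assumes "norm z = 1"
  shows "(norm (poly (rudin_shapiro_P n) z))\<^sup>2 + (norm (poly (rudin_shapiro_Q n) z))\<^sup>2 = 2 ^ Suc n"
proof (induction n)
  case (Suc n)
  let ?P = "poly (rudin_shapiro_P n) z" and ?Q = "z ^ 2 ^ n * poly (rudin_shapiro_Q n) z"
  have "(norm (?P + ?Q))\<^sup>2 + (norm (?P - ?Q))\<^sup>2 = 2 * ((norm ?P)\<^sup>2 + (norm ?Q)\<^sup>2)"
    unfolding cmod_power2 by (simp add: power2_eq_square algebra_simps)
  with Suc assms show ?case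
    by (simp add: poly_monom norm_mult norm_power)
qed simp

lemma degree_rudin_shapiro:
  "degree (rudin_shapiro_P n) < 2 ^ n \<and> degree (rudin_shapiro_Q n) < 2 ^ n"
proof (induction n)
  case (Suc n)
  have "degree (monom (1::complex) (2 ^ n) * rudin_shapiro_Q n) < 2 ^ Suc n"
    using Suc degree_mult_le[of "monom (1::complex) (2 ^ n)" "rudin_shapiro_Q n"]
      degree_monom_le[of "1::complex" "2 ^ n"] by simp
  with Suc show ?case
    by (auto intro!: degree_add_less degree_diff_less)
qed simp

lemma circle_integral_rudin_shapiro:
  "(LINT z|circle_measure. (norm (poly (rudin_shapiro_P n) z))\<^sup>2) = 2 ^ n"
proof (cases n)
  case (Suc m)
  let ?c = "\<lambda>z. z ^ 2 ^ m * poly (rudin_shapiro_Q m) z * cnj (poly (rudin_shapiro_P m) z)"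
  have "(norm (poly (rudin_shapiro_P n) z))\<^sup>2 = 2 ^ n + 2 * Re (?c z)" if "norm z = 1" for z
    using that rudin_shapiro_sum_squares[of z m]
    by (simp add: Suc poly_monom norm_add_square_complex norm_mult norm_power)
  then have "(LINT z|circle_measure. (norm (poly (rudin_shapiro_P n) z))\<^sup>2)
      = (LINT z|circle_measure. 2 ^ n + 2 * Re (?c z))"
    by (intro Bochner_Integration.integral_cong) (auto simp: space_circle_measure)
  also have "\<dots> = 2 ^ n + 2 * (LINT z|circle_measure. Re (?c z))"
    by (subst Bochner_Integration.integral_add)
       (auto intro!: integrable_circle_continuous continuous_intros  simp: circle.prob_space
         simp del: times_complex.sel)
  also have "(LINT z|circle_measure. Re (?c z)) = Re (LINT z|circle_measure. ?c z)"
    by (rule circle_integral_Re) (intro continuous_intros)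
  also have "(LINT z|circle_measure. ?c z) = 0"
    by (intro circle_orthogonal) (simp add: degree_rudin_shapiro)
  finally show ?thesis
    by simp
qed (simp add: circle.prob_space)

lemma circle_norm_rudin_shapiro:
  "circle_norm 2 (poly (rudin_shapiro_P n)) = 2 powr (real n / 2)"
  by (simp add: circle_norm_def circle_integral_rudin_shapiro powr_realpow[symmetric] powr_powr)

section \<open>Failure of flatness in every exponent\<close>

lemma norm_rudin_shapiro_normalized:
  "(norm (poly (rudin_shapiro_normalized n) z))\<^sup>2 = (norm (poly (rudin_shapiro_P n) z))\<^sup>2 / 2 ^ n"
proof -
  have "(2 powr (real n / 2))\<^sup>2 = (2::real) ^ n"
    by (simp add: powr_powr powr_realpow[symmetric] flip: powr_numeral)
  then show ?thesis
    by (simp add: rudin_shapiro_normalized_def circle_norm_rudin_shapiro norm_mult norm_divide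
        power_divide)
qed

lemma norm_rudin_shapiro_normalized_le:
  assumes "norm z = 1"
  shows "(norm (poly (rudin_shapiro_normalized n) z))\<^sup>2 \<le> 2"
proof -
  have "(norm (poly (rudin_shapiro_P n) z))\<^sup>2 \<le> 2 * 2 ^ n"
    using rudin_shapiro_sum_squares[OF assms, of n]
      zero_le_power2[of "norm (poly (rudin_shapiro_Q n) z)"] unfolding power_Suc by linarith
  then show ?thesis
    by (simp add: norm_rudin_shapiro_normalized field_simps)
qed

lemma norm_rudin_shapiro_normalized_dist:
  assumes "norm z = 1"
  shows "\<bar>norm (poly (rudin_shapiro_normalized n) z) - 1\<bar> \<le> 1"
proof -
  have "norm (poly (rudin_shapiro_normalized n) z) \<le> 2"
    by (rule power2_le_imp_le) (use norm_rudin_shapiro_normalized_le[OF assms, of n] in auto)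
  then show ?thesis
    using norm_ge_zero[of "poly (rudin_shapiro_normalized n) z"] by linarith
qed

text \<open>The inequality \<open>three_step_inequality\<close> for \<open>P\<^sub>n\<close> and \<open>Q\<^sub>n\<close> divided by \<open>2^(n/2)\<close>. Passing from
  \<open>f\<^sup>2 - 1\<close> to \<open>f - 1\<close> costs the factor \<open>(f + 1)\<^sup>2 \<le> 6\<close>, which comes from \<open>f\<^sup>2 \<le> 2\<close>.\<close>

lemma three_step_rudin_shapiro:
  fixes n :: nat and z :: complex
  defines "f \<equiv> \<lambda>k. norm (poly (rudin_shapiro_normalized k) z)"
  assumes z: "norm z = 1"
  shows "(Im (z ^ 2 ^ Suc n))\<^sup>2
       \<le> 18 * (f n - 1)\<^sup>2 + 6 * (f (Suc n) - 1)\<^sup>2 + 12 * (f (Suc (Suc n)) - 1)\<^sup>2"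
proof -
  define s where "s = complex_of_real (sqrt (2 ^ n))"
  define p q w where "p = poly (rudin_shapiro_P n) z / s"
    and "q = poly (rudin_shapiro_Q n) z / s" and "w = z ^ 2 ^ n"
  have s: "s \<noteq> 0" "(norm s)\<^sup>2 = 2 ^ n"
    by (simp_all add: s_def norm_power)
  have w2: "w\<^sup>2 = z ^ 2 ^ Suc n"
    by (simp add: w_def power_mult[symmetric] mult.commute)
  have P1: "poly (rudin_shapiro_P (Suc n)) z = s * (p + w * q)"
    using s by (simp add: p_def q_def w_def poly_monom field_simps)
  have Q1: "poly (rudin_shapiro_Q (Suc n)) z = s * (p - w * q)"
    using s by (simp add: p_def q_def w_def poly_monom field_simps)
  have P2: "poly (rudin_shapiro_P (Suc (Suc n))) z = s * ((p + w * q) + w\<^sup>2 * (p - w * q))"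
    unfolding rudin_shapiro_P.simps(2)[of "Suc n"] poly_add poly_mult P1 Q1 w2 poly_monom
    by (simp add: algebra_simps)
  have "(norm p)\<^sup>2 + (norm q)\<^sup>2 = 2"
    using rudin_shapiro_sum_squares[OF z, of n]
    by (simp add: p_def q_def norm_divide power_divide s flip: add_divide_distrib)
  moreover have "norm w = 1"
    using z by (simp add: w_def norm_power)
  ultimately have "(Im (w\<^sup>2))\<^sup>2 \<le> 3 * ((norm p)\<^sup>2 - 1)\<^sup>2 + ((norm (p + w * q))\<^sup>2 / 2 - 1)\<^sup>2
      + 2 * ((norm ((p + w * q) + w\<^sup>2 * (p - w * q)))\<^sup>2 / 4 - 1)\<^sup>2"
    by (intro three_step_inequality)
  moreover have "(norm p)\<^sup>2 = (f n)\<^sup>2"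
    by (simp add: f_def norm_rudin_shapiro_normalized p_def norm_divide power_divide s)
  moreover have "(norm (p + w * q))\<^sup>2 / 2 = (f (Suc n))\<^sup>2"
    unfolding f_def norm_rudin_shapiro_normalized P1 norm_mult power_mult_distrib s by simp
  moreover have "(norm ((p + w * q) + w\<^sup>2 * (p - w * q)))\<^sup>2 / 4 = (f (Suc (Suc n)))\<^sup>2"
    unfolding f_def norm_rudin_shapiro_normalized P2 norm_mult power_mult_distrib s by simp
  ultimately have *: "(Im (z ^ 2 ^ Suc n))\<^sup>2
      \<le> 3 * ((f n)\<^sup>2 - 1)\<^sup>2 + ((f (Suc n))\<^sup>2 - 1)\<^sup>2 + 2 * ((f (Suc (Suc n)))\<^sup>2 - 1)\<^sup>2"
    by (simp only: w2)
  have le: "((f k)\<^sup>2 - 1)\<^sup>2 \<le> 6 * (f k - 1)\<^sup>2" for k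
  proof -
    have f2: "(f k)\<^sup>2 \<le> 2"
      using norm_rudin_shapiro_normalized_le[OF z, of k] by (simp add: f_def)
    moreover have "f k \<le> 3 / 2"
      by (rule power2_le_imp_le) (use f2 in \<open>auto simp: power2_eq_square\<close>)
    ultimately have "(f k + 1)\<^sup>2 \<le> 6"
      by (simp add: power2_sum)
    then have "(f k + 1)\<^sup>2 * (f k - 1)\<^sup>2 \<le> 6 * (f k - 1)\<^sup>2"
      by (intro mult_right_mono) auto
    moreover have "((f k)\<^sup>2 - 1)\<^sup>2 = (f k + 1)\<^sup>2 * (f k - 1)\<^sup>2"
      by (simp add: power2_eq_square algebra_simps)
    ultimately show ?thesis
      by simp
  qed
  show ?thesis
    using * le[of n] le[of "Suc n"] le[of "Suc (Suc n)"] by linarith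
qed

lemma integrable_rudin_shapiro_dist:
  "integrable circle_measure (\<lambda>z. (norm (poly (rudin_shapiro_normalized n) z) - 1)\<^sup>2)"
  by (intro integrable_circle_continuous continuous_intros)

lemma rudin_shapiro_not_L2_flat:
  "\<not> (\<lambda>n. LINT z|circle_measure. (norm (poly (rudin_shapiro_normalized n) z) - 1)\<^sup>2) \<longlonglongrightarrow> 0"
  (is "\<not> ?d \<longlonglongrightarrow> 0")
proof
  assume lim: "?d \<longlonglongrightarrow> 0"
  have ge: "1 / 2 \<le> 18 * ?d n + 6 * ?d (Suc n) + 12 * ?d (Suc (Suc n))" for n
  proof -
    let ?g = "\<lambda>k z. (norm (poly (rudin_shapiro_normalized k) z) - 1)\<^sup>2"
    have "1 / 2 = (LINT z|circle_measure. (Im (z ^ 2 ^ Suc n))\<^sup>2)"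
      by (simp only: circle_integral_Im_power zero_less_power zero_less_numeral)
    also have "\<dots> \<le> (LINT z|circle_measure.
        18 * ?g n z + 6 * ?g (Suc n) z + 12 * ?g (Suc (Suc n)) z)"
      by (intro integral_mono integrable_circle_continuous continuous_intros
          three_step_rudin_shapiro) (simp add: space_circle_measure)
    also have "\<dots> = 18 * ?d n + 6 * ?d (Suc n) + 12 * ?d (Suc (Suc n))"
      using integrable_rudin_shapiro_dist by simp
    finally show ?thesis .
  qed
  have "(\<lambda>n. 18 * ?d n + 6 * ?d (Suc n) + 12 * ?d (Suc (Suc n)))
      \<longlonglongrightarrow> 18 * 0 + 6 * 0 + 12 * 0"
    by (intro tendsto_intros lim LIMSEQ_Suc[OF lim] LIMSEQ_Suc[OF LIMSEQ_Suc[OF lim]])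
  from LIMSEQ_le_const[OF this] ge have "(1 / 2 :: real) \<le> 18 * 0 + 6 * 0 + 12 * 0"
    by blast
  then show False
    by simp
qed

text \<open>For \<open>\<bar>g\<bar> \<le> 1\<close> and any \<open>e > 0\<close>, \<open>g\<^sup>2 \<le> e\<^sup>2 + (\<bar>g\<bar> / e) powr \<alpha>\<close>: either \<open>\<bar>g\<bar> \<le> e\<close>, or
  the last term is at least 1. This treats \<open>\<alpha> < 2\<close> and \<open>\<alpha> > 2\<close> at once, without Hoelder's
  inequality.\<close>

lemma (in prob_space) square_integral_tendsto_0:
  fixes g :: "nat \<Rightarrow> 'a \<Rightarrow> real"
  assumes meas: "\<And>n. g n \<in> borel_measurable M"
    and bound: "\<And>n x. x \<in> space M \<Longrightarrow> \<bar>g n x\<bar> \<le> 1"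
    and \<alpha>: "\<alpha> > 0"
    and lim: "(\<lambda>n. LINT x|M. \<bar>g n x\<bar> powr \<alpha>) \<longlonglongrightarrow> 0"
  shows "(\<lambda>n. LINT x|M. (g n x)\<^sup>2) \<longlonglongrightarrow> 0"
proof (rule order_tendstoI)
  fix a :: real assume a: "a < 0"
  have "0 \<le> (LINT x|M. (g n x)\<^sup>2)" for n
    by simp
  with a show "\<forall>\<^sub>F n in sequentially. a < (LINT x|M. (g n x)\<^sup>2)"
    by (intro always_eventually allI) (rule less_le_trans)
next
  fix a :: real assume a: "0 < a"
  \<comment> \<open>The contribution \<open>e\<^sup>2\<close> of the points with \<open>\<bar>g\<bar> \<le> e\<close> is half of the target \<open>a\<close>.\<close>
  define e where "e = sqrt (a / 2)"
  have e: "e > 0" "e\<^sup>2 = a / 2"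
    using a by (simp_all add: e_def)
  have pw: "(g n x)\<^sup>2 \<le> e\<^sup>2 + (1 / e) powr \<alpha> * \<bar>g n x\<bar> powr \<alpha>" if "x \<in> space M" for n x
  proof (cases "\<bar>g n x\<bar> \<le> e")
    case True
    then have "(g n x)\<^sup>2 \<le> e\<^sup>2"
      by (metis abs_ge_zero power2_abs power_mono)
    then show ?thesis
      by (simp add: add_increasing2)
  next
    case False
    then have "1 \<le> ((1 / e) * \<bar>g n x\<bar>) powr \<alpha>"
      using e \<alpha> by (intro ge_one_powr_ge_zero) (auto simp: field_simps)
    moreover have "(g n x)\<^sup>2 \<le> 1"
      using bound[OF that, of n] by (simp add: abs_square_le_1)
    moreover have "((1 / e) * \<bar>g n x\<bar>) powr \<alpha> = (1 / e) powr \<alpha> * \<bar>g n x\<bar> powr \<alpha>"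
      by (rule powr_mult)
    ultimately show ?thesis
      using zero_le_power2[of e] by linarith
  qed
  have int1: "integrable M (\<lambda>x. (g n x)\<^sup>2)" for n
    using bound meas[of n]
    by (intro integrable_const_bound[where B = 1] AE_I2) (auto simp: abs_square_le_1)
  have int2: "integrable M (\<lambda>x. \<bar>g n x\<bar> powr \<alpha>)" for n
    using bound meas[of n] \<alpha>
    by (intro integrable_const_bound[where B = 1] AE_I2) (auto intro!: powr_le1)
  have le: "(LINT x|M. (g n x)\<^sup>2) \<le> a / 2 + (1 / e) powr \<alpha> * (LINT x|M. \<bar>g n x\<bar> powr \<alpha>)" for n
  proof -
    have "(LINT x|M. (g n x)\<^sup>2) \<le> (LINT x|M. e\<^sup>2 + (1 / e) powr \<alpha> * \<bar>g n x\<bar> powr \<alpha>)"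
      using int1 int2 pw by (intro integral_mono) auto
    also have "\<dots> = a / 2 + (1 / e) powr \<alpha> * (LINT x|M. \<bar>g n x\<bar> powr \<alpha>)"
      using int2 e by (simp add: prob_space)
    finally show ?thesis .
  qed
  have "(\<lambda>n. a / 2 + (1 / e) powr \<alpha> * (LINT x|M. \<bar>g n x\<bar> powr \<alpha>))
      \<longlonglongrightarrow> a / 2 + (1 / e) powr \<alpha> * 0"
    by (intro tendsto_intros lim)
  then have "\<forall>\<^sub>F n in sequentially. a / 2 + (1 / e) powr \<alpha> * (LINT x|M. \<bar>g n x\<bar> powr \<alpha>) < a"
    by (rule order_tendstoD) (use a in simp)
  then show "\<forall>\<^sub>F n in sequentially. (LINT x|M. (g n x)\<^sup>2) < a"
    by eventually_elim (rule le_less_trans[OF le])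
qed

text \<open>Because \<open>\<parallel>X\<parallel>\<^sub>2 = 1\<close>, the left-hand side is \<open>2 - 2 * \<parallel>X\<parallel>\<^sub>1\<close>, and \<open>\<parallel>X\<parallel>\<^sub>1 \<ge> 1 + ln M(X)\<close> by integrating
  \<open>ln x \<le> x - 1\<close>. Positivity of the Mahler measure guarantees that \<open>ln |X|\<close> is integrable and
  that \<open>X\<close> is nonzero almost everywhere; at a zero of \<open>X\<close> the pointwise bound fails because \<open>ln 0 = 0\<close>.\<close>

lemma rudin_shapiro_L2_dist_le_mahler:
  fixes n :: nat
  defines "X \<equiv> poly (rudin_shapiro_normalized n)"
  assumes pos: "mahler_measure X > 0"
  shows "(LINT z|circle_measure. (norm (X z) - 1)\<^sup>2) \<le> - 2 * ln (mahler_measure X)"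
proof -
  have ae: "AE z in circle_measure. X z \<noteq> 0"
    and int: "integrable circle_measure (\<lambda>z. ln (norm (X z)))"
    and M: "mahler_measure X = exp (LINT z|circle_measure. ln (norm (X z)))"
    using pos by (auto simp: mahler_measure_def split: if_splits)
  have int2: "integrable circle_measure (\<lambda>z. (norm (X z))\<^sup>2)"
    unfolding X_def by (intro integrable_circle_continuous continuous_intros)
  have one: "(LINT z|circle_measure. (norm (X z))\<^sup>2) = 1"
    by (simp add: X_def norm_rudin_shapiro_normalized circle_integral_rudin_shapiro)
  have "(LINT z|circle_measure. (norm (X z) - 1)\<^sup>2)
      \<le> (LINT z|circle_measure. (norm (X z))\<^sup>2 - 1 - 2 * ln (norm (X z)))"
  proof (rule integral_mono_AE)
    show "AE z in circle_measure. (norm (X z) - 1)\<^sup>2 \<le> (norm (X z))\<^sup>2 - 1 - 2 * ln (norm (X z))"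
      using ae
    proof eventually_elim
      case (elim z)
      then show ?case
        using ln_le_minus_one[of "norm (X z)"] by (simp add: power2_diff)
    qed
  qed (use int int2 integrable_rudin_shapiro_dist in \<open>auto simp: X_def\<close>)
  also have "\<dots> = - 2 * ln (mahler_measure X)"
    using int int2 one by (simp add: M circle.prob_space)
  finally show ?thesis .
qed

lemma rudin_shapiro_not_L0_flat: "\<not> L_flat 0 rudin_shapiro_normalized"
proof
  let ?M = "\<lambda>n. mahler_measure (poly (rudin_shapiro_normalized n))"
  assume "L_flat 0 rudin_shapiro_normalized"
  then have lim: "?M \<longlonglongrightarrow> 1"
    by (simp add: L_flat_def)
  have "(\<lambda>n. LINT z|circle_measure. (norm (poly (rudin_shapiro_normalized n) z) - 1)\<^sup>2) \<longlonglongrightarrow> 0"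
  proof (rule tendsto_sandwich[where f = "\<lambda>_. 0" and h = "\<lambda>n. - 2 * ln (?M n)"])
    have "\<forall>\<^sub>F n in sequentially. 0 < ?M n"
      using order_tendstoD(1)[OF lim] by simp
    then show "\<forall>\<^sub>F n in sequentially.
        (LINT z|circle_measure. (norm (poly (rudin_shapiro_normalized n) z) - 1)\<^sup>2)
          \<le> - 2 * ln (?M n)"
      by eventually_elim (rule rudin_shapiro_L2_dist_le_mahler)
    have "(\<lambda>n. - 2 * ln (?M n)) \<longlonglongrightarrow> - 2 * ln 1"
      by (intro tendsto_intros lim) simp
    then show "(\<lambda>n. - 2 * ln (?M n)) \<longlonglongrightarrow> 0"
      by simp
  qed (auto intro!: always_eventually)
  then show False
    using rudin_shapiro_not_L2_flat by contradiction
qed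

lemma rudin_shapiro_not_L_flat_pos:
  assumes \<alpha>: "\<alpha> > 0"
  shows "\<not> L_flat \<alpha> rudin_shapiro_normalized"
proof
  let ?g = "\<lambda>n z. norm (poly (rudin_shapiro_normalized n) z) - 1"
  let ?I = "\<lambda>n. LINT z|circle_measure. \<bar>?g n z\<bar> powr \<alpha>"
  assume "L_flat \<alpha> rudin_shapiro_normalized"
  then have "(\<lambda>n. ?I n powr (1 / \<alpha>)) \<longlonglongrightarrow> 0"
    using \<alpha> by (simp add: L_flat_def circle_norm_def)
  then have "(\<lambda>n. (?I n powr (1 / \<alpha>)) powr \<alpha>) \<longlonglongrightarrow> 0 powr \<alpha>"
    by (intro tendsto_powr' tendsto_const) (use \<alpha> in auto)
  moreover have "(?I n powr (1 / \<alpha>)) powr \<alpha> = ?I n" for n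
    using \<alpha> by (simp add: powr_powr)
  ultimately have "?I \<longlonglongrightarrow> 0"
    by simp
  then have "(\<lambda>n. LINT z|circle_measure. (?g n z)\<^sup>2) \<longlonglongrightarrow> 0"
    by (intro circle.square_integral_tendsto_0[OF _ _ \<alpha>] measurable_circle_continuous
        continuous_intros norm_rudin_shapiro_normalized_dist) (simp_all add: space_circle_measure)
  then show False
    using rudin_shapiro_not_L2_flat by contradiction
qed

theorem theorem2p2:
  shows "(\<forall>n. circle_norm 2 (poly (rudin_shapiro_P n)) = 2 powr (real n / 2)) \<and>
         (\<forall>\<alpha>::real. \<alpha> \<ge> 0 \<longrightarrow> \<not> L_flat \<alpha> rudin_shapiro_normalized)"
  using circle_norm_rudin_shapiro rudin_shapiro_not_L0_flat rudin_shapiro_not_L_flat_pos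
  by (metis less_eq_real_def)

end
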